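(* Let $q=p^{e}$ be a power of a prime $p$, and let $f(X)\in\mathbb{F}_q[X]$ be a nonconstant monic polynomial coprime to $X$. Let $\mathrm{rad}(f)$ be the product of the distinct monic irreducible factors of $f$, let $m=\mathrm{ord}(\mathrm{rad}(f))$, and let $T_{\mathrm{rad}(f)}\subseteq\mathbb{Z}/m\mathbb{Z}$ be the primitive defining set of $\mathrm{rad}(f)$. Then $f(X)$ is a binomial if and only if there is a nonnegative integer $v$ such that $f(X)=\mathrm{rad}(f)^{p^{v}}$ and $T_{\mathrm{rad}(f)}$ is an equal-difference subset of $\mathbb{Z}/m\mathbb{Z}$.
   Context: A binomial is a polynomial of the form $X^{n}-\lambda$ with $n\geq 1$ and $\lambda\in\mathbb{F}_q^{\ast}$. The order $\mathrm{ord}(g)$ of a nonconstant polynomial $g$ coprime to $X$ is the least positive integer $m$ with $g\mid X^{m}-1$. Fix, in an algebraic closure of $\mathbb{F}_q$, a family $\{\zeta_n:\gcd(n,q)=1\}$ of primitive $n$-th roots of unity that is compatible: $\zeta_n^{n/m}=\zeta_m$ whenever $m\mid n$. If $g$ is squarefree, coprime to $X$, with order $m$ (then $\gcd(m,q)=1$), its primitive defining set is the subset $T_g\subseteq\mathbb{Z}/m\mathbb{Z}$ such that $g(X)=a\prod_{\gamma\in T_g}(X-\zeta_m^{\gamma})$ for some $a\in\mathbb{F}_q^{\ast}$. A subset $E\subseteq\mathbb{Z}/m\mathbb{Z}$ is an equal-difference subset if $E=\{\gamma,\gamma+d,\dots,\gamma+(\tfrac{m}{d}-1)d\}$ for some $\gamma$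 and some positive divisor $d$ of $m$ (the common difference). *)

theory Defs
  imports "HOL-Algebra.Algebraic_Closure_Type"
begin

(* HOL-Algebra reuses the names degree, irreducible, prime and others for its
   locale-based notions; qualified names select the type-class versions. *)

definition is_binomial :: "'a::field poly \<Rightarrow> bool" where
  "is_binomial f \<longleftrightarrow>
     (\<exists>n l. n \<ge> 1 \<and> l \<noteq> 0 \<and> f = [:0, 1:] ^ n - [:l:])"

definition poly_order :: "'a::field poly \<Rightarrow> nat" where
  "poly_order g = (LEAST m. m > 0 \<and> g dvd [:0, 1:] ^ m - 1)"

definition poly_rad :: "'a::field poly \<Rightarrow> 'a poly" where
  "poly_rad f =
     (\<Prod>g | Factorial_Ring.irreducible g \<and> Polynomial.lead_coeff g = 1 \<and> g dvd f. g)"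

definition primitive_root_of_unity :: "nat \<Rightarrow> 'b::field \<Rightarrow> bool" where
  "primitive_root_of_unity n z \<longleftrightarrow>
     n > 0 \<and> z ^ n = 1 \<and> (\<forall>k. 0 < k \<and> k < n \<longrightarrow> z ^ k \<noteq> 1)"

definition compatible_roots_of_unity :: "nat \<Rightarrow> (nat \<Rightarrow> 'b::field) \<Rightarrow> bool" where
  "compatible_roots_of_unity q \<zeta> \<longleftrightarrow>
     (\<forall>n. coprime n q \<longrightarrow> primitive_root_of_unity n (\<zeta> n)) \<and>
     (\<forall>n m. coprime n q \<and> m dvd n \<longrightarrow> \<zeta> n ^ (n div m) = \<zeta> m)"

(* Residue classes modulo m are represented throughout by their representatives
   in {0..<m}. The set below is unique (and exists) for nonconstant squarefree g
   coprime to X over a finite field; the description is meant for such g only. *)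
definition primitive_defining_set ::
    "(nat \<Rightarrow> 'a alg_closure) \<Rightarrow> 'a::field poly \<Rightarrow> nat set" where
  "primitive_defining_set \<zeta> g =
     (THE T. T \<subseteq> {0..<poly_order g} \<and>
        (\<exists>a::'a. a \<noteq> 0 \<and>
           map_poly to_ac g =
             Polynomial.smult (to_ac a) (\<Prod>\<gamma>\<in>T. [:- (\<zeta> (poly_order g) ^ \<gamma>), 1:])))"

definition equal_difference_subset :: "nat \<Rightarrow> nat set \<Rightarrow> bool" where
  "equal_difference_subset m E \<longleftrightarrow>
     (\<exists>\<gamma> d. \<gamma> < m \<and> d > 0 \<and> d dvd m \<and>
        E = (\<lambda>i. (\<gamma> + i * d) mod m) ` {0..<m div d})"

end

theory Submission
  imports Defs
begin

text \<open>
  Let \<open>R\<close> be the set of roots of \<open>f\<close> in the algebraic closure, \<open>r = rad(f)\<close> and \<open>m = ord(r)\<close>. A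
  radical that divides a power \<open>h\<^sup>k\<close> divides \<open>h\<close>, so minimality of \<open>m\<close> and
  \<open>X\<^sup>p\<^sup>k - 1 = (X\<^sup>k - 1)\<^sup>p\<close> show that \<open>p\<close> does not divide \<open>m\<close>. Thus \<open>X\<^sup>m - 1\<close> is separable, \<open>r\<close> is the
  product of the \<open>X - x\<close> for \<open>x \<in> R\<close>, and the defining set consists of the \<open>\<gamma> < m\<close> with
  \<open>\<zeta>\<^sub>m\<^sup>\<gamma> \<in> R\<close>. This set is equal-difference with difference \<open>d\<close> iff \<open>R\<close> is the set of all roots of
  some \<open>X\<^sup>n - c\<close> with \<open>n = m/d\<close>, that is, iff \<open>r = X\<^sup>n - c\<close>. Finally, a binomial of degree
  \<open>p\<^sup>v n\<close> with \<open>p\<close> not dividing \<open>n\<close> is the \<open>p\<^sup>v\<close>-th power of a separable binomial of degree \<open>n\<close>,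
  because Frobenius is bijective on a finite field.
\<close>

section \<open>Passage to the algebraic closure and divisibility by prime factors\<close>

abbreviation ac_poly :: "'a::field poly \<Rightarrow> 'a alg_closure poly" where
  "ac_poly \<equiv> map_poly to_ac"

lemma ac_poly_mult: "ac_poly (p * q) = ac_poly p * ac_poly q"
  by (rule poly_eqI) (simp add: coeff_map_poly Polynomial.coeff_mult to_ac_sum)

lemma ac_poly_diff: "ac_poly (p - q) = ac_poly p - ac_poly q"
  by (rule poly_eqI) (simp add: coeff_map_poly)

lemma ac_poly_1: "ac_poly 1 = 1"
  by (rule poly_eqI) (simp add: coeff_map_poly)

lemma ac_poly_power: "ac_poly (p ^ n) = ac_poly p ^ n"
  by (induction n) (simp_all add: ac_poly_mult ac_poly_1)

lemma ac_poly_binomial: "ac_poly ([:0, 1:] ^ n - [:l:]) = [:0, 1:] ^ n - [:to_ac l:]"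
  by (simp add: ac_poly_diff ac_poly_power map_poly_pCons)

lemma ac_poly_dvd: "p dvd q \<Longrightarrow> ac_poly p dvd ac_poly q"
  by (auto simp: ac_poly_mult elim!: dvdE)

lemma lead_coeff_ac_poly: "Polynomial.lead_coeff (ac_poly p) = to_ac (Polynomial.lead_coeff p)"
  by (simp add: coeff_map_poly degree_map_poly)

lemma ac_poly_eq_iff: "ac_poly p = ac_poly q \<longleftrightarrow> p = q"
  by (auto simp: poly_eq_iff coeff_map_poly)

text \<open>Among the nonzero divisors of \<open>f\<close> vanishing at \<open>x\<close>, one of
  least degree is irreducible: one factor of any factorization still vanishes at \<open>x\<close>,
  and minimality makes the other factor constant. This is what ensures that the radical keeps every
  root of \<open>f\<close>.\<close>

lemma minimal_polynomial_exists:
  fixes f :: "'a::field poly"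
  assumes "f \<noteq> 0" and "poly (ac_poly f) x = 0"
  shows "\<exists>g. Factorial_Ring.irreducible g \<and> Polynomial.lead_coeff g = 1 \<and>
    poly (ac_poly g) x = 0 \<and> g dvd f"
proof -
  define P where "P = (\<lambda>g. g \<noteq> 0 \<and> g dvd f \<and> poly (ac_poly g) x = 0)"
  have "P f"
    using assms by (simp add: P_def)
  then obtain g where g: "P g" and min: "\<And>h. P h \<Longrightarrow> Polynomial.degree g \<le> Polynomial.degree h"
    using ex_has_least_nat[of P f Polynomial.degree] by blast
  have unit: "b dvd 1" if "P a" "g = a * b" for a b
  proof -
    have "a \<noteq> 0" "b \<noteq> 0"
      using g that(2) by (auto simp: P_def)
    then have "Polynomial.degree b = 0"
      using min[OF that(1)] that(2) by (simp add: Polynomial.degree_mult_eq)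
    then show ?thesis
      using \<open>b \<noteq> 0\<close> by (auto simp: is_unit_iff_degree)
  qed
  have "Factorial_Ring.irreducible g"
  proof (rule irreducibleI)
    show "g \<noteq> 0"
      using g by (simp add: P_def)
    show "\<not> g dvd 1"
    proof
      assume "g dvd 1"
      then have "ac_poly g dvd 1"
        using ac_poly_dvd[of g 1] by (simp add: ac_poly_1)
      then obtain k where "1 = ac_poly g * k" ..
      then have "poly 1 x = poly (ac_poly g) x * poly k x"
        by (simp flip: poly_mult)
      then show False
        using g by (simp add: P_def)
    qed
    fix a b assume ab: "g = a * b"
    then have "a \<noteq> 0" "b \<noteq> 0" "a dvd f" "b dvd f"
      using g by (auto simp: P_def intro: dvd_trans)
    moreover have "poly (ac_poly a) x = 0 \<or> poly (ac_poly b) x = 0"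
      using g ab by (simp add: P_def ac_poly_mult)
    ultimately have "P a \<or> P b"
      by (auto simp: P_def)
    then show "a dvd 1 \<or> b dvd 1"
      using unit[of a b] unit[of b a] ab by (auto simp: mult.commute)
  qed
  \<comment> \<open>Division by the leading coefficient makes \<open>g\<close> monic, as
    \<open>poly_rad\<close> requires of its factors.\<close>
  moreover define c where "c = inverse (Polynomial.lead_coeff g)"
  moreover have "c \<noteq> 0"
    using g by (simp add: P_def c_def)
  ultimately have "Factorial_Ring.irreducible (Polynomial.smult c g)"
    using irreducible_mult_unit_left[of "[:c:]" g] by (simp add: is_unit_const_poly_iff dvd_field_iff)
  moreover have "poly (ac_poly (Polynomial.smult c g)) x = 0"
    using g ac_poly_mult[of "[:c:]" g] by (simp add: P_def)
  ultimately show ?thesis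
    using g \<open>c \<noteq> 0\<close>
    by (intro exI[of _ "Polynomial.smult c g"]) (auto simp: P_def c_def lead_coeff_smult smult_dvd_iff)
qed

text \<open>Dividing \<open>h\<close> by one \<open>f i\<close> leaves a cofactor that every other
  \<open>f j\<close> still divides, since \<open>f j\<close> is prime and does not divide
  \<open>f i\<close>. It serves both for linear factors over the closure and for monic irreducible
  factors over the base field.\<close>

lemma prod_dvd_of_prime_elems:
  fixes h :: "'a::algebraic_semidom"
  assumes "finite S" and "\<And>i. i \<in> S \<Longrightarrow> prime_elem (f i)" and "\<And>i. i \<in> S \<Longrightarrow> f i dvd h"
    and "\<And>i j. i \<in> S \<Longrightarrow> j \<in> S \<Longrightarrow> f i dvd f j \<Longrightarrow> i = j"
  shows "prod f S dvd h"
  using assms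
proof (induction S arbitrary: h rule: finite_induct)
  case (insert i S)
  obtain k where k: "h = f i * k"
    using insert.prems(2) by blast
  have "f j dvd k" if "j \<in> S" for j
  proof -
    have "\<not> f j dvd f i"
      using insert.prems(3)[of j i] insert.hyps that by auto
    moreover have "f j dvd f i * k"
      using insert.prems(2)[of j] that k by auto
    ultimately show ?thesis
      using insert.prems(1)[of j] that by (auto simp: prime_elem_dvd_mult_iff)
  qed
  then have "prod f S dvd k"
    using insert.prems by (intro insert.IH) auto
  then show ?case
    using insert.hyps k by (simp add: mult_dvd_mono)
qed simp

section \<open>Separable polynomials and binomials\<close>

lemma degree_lead_coeff_binomial:
  fixes c :: "'b::field"
  assumes "n > 0"
  shows "Polynomial.degree ([:0, 1:] ^ n - [:c:]) = n"
    and "Polynomial.lead_coeff ([:0, 1:] ^ n - [:c:]) = 1"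
proof -
  have d: "Polynomial.degree ([:0, 1:] ^ n :: 'b poly) = n"
    by (simp add: degree_linear_power)
  have "Polynomial.degree ([:0, 1:] ^ n + - [:c:]) = n"
    using assms d by (subst degree_add_eq_left) auto
  then show *: "Polynomial.degree ([:0, 1:] ^ n - [:c:]) = n"
    by (simp only: diff_conv_add_uminus)
  have "Polynomial.lead_coeff ([:0, 1:] ^ n :: 'b poly) = 1"
    by (simp add: lead_coeff_power)
  then show "Polynomial.lead_coeff ([:0, 1:] ^ n - [:c:]) = 1"
    using assms d * by (cases n) (auto simp: coeff_eq_0)
qed

text \<open>By the product rule, a double root of \<open>p\<close> is also a root of its
  derivative.\<close>

lemma rsquarefree_if_no_root_pderiv:
  fixes p :: "'b::field poly"
  assumes "p \<noteq> 0" and "\<And>a. poly p a = 0 \<Longrightarrow> poly (pderiv p) a \<noteq> 0"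
  shows "rsquarefree p"
proof -
  have "Polynomial.order a p \<le> 1" for a
  proof (rule ccontr)
    assume "\<not> ?thesis"
    then have "[:-a, 1:] ^ 2 dvd p"
      by (simp add: order_divides)
    then obtain q where q: "p = [:-a, 1:] * ([:-a, 1:] * q)"
      by (elim dvdE) (simp only: power2_eq_square mult.assoc)
    then have "poly p a = 0" "poly (pderiv p) a = 0"
      by (simp_all only: pderiv_mult) simp_all
    then show False
      using assms(2) by blast
  qed
  then show ?thesis
    using assms(1) by (force simp: rsquarefree_def le_Suc_eq)
qed

text \<open>The derivative \<open>n * X^(n-1)\<close> can vanish only at 0, and 0 is not a root
  because \<open>c\<close> is nonzero.\<close>

lemma rsquarefree_binomial:
  fixes c :: "'b::field"
  assumes "of_nat n \<noteq> (0 :: 'b)" and "c \<noteq> 0"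
  shows "rsquarefree ([:0, 1:] ^ n - [:c:])"
proof (rule rsquarefree_if_no_root_pderiv)
  have n: "n > 0"
    using assms(1) by (cases n) auto
  show "[:0, 1:] ^ n - [:c:] \<noteq> 0"
    using degree_lead_coeff_binomial[OF n, of c] by auto
  fix a assume "poly ([:0, 1:] ^ n - [:c:]) a = 0"
  then have "a \<noteq> 0"
    using n assms(2) by auto
  then show "poly (pderiv ([:0, 1:] ^ n - [:c:])) a \<noteq> 0"
    using assms(1) n by (simp add: pderiv_diff pderiv_power pderiv_pCons)
qed

lemma rsquarefree_dvd:
  fixes p q :: "'b::idom poly"
  assumes "rsquarefree q" and "p dvd q"
  shows "rsquarefree p"
proof -
  have "q \<noteq> 0" "p \<noteq> 0"
    using assms by (auto simp: rsquarefree_def)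
  moreover have "Polynomial.order a p \<le> Polynomial.order a q" for a
    using dvd_imp_order_le assms(2) \<open>q \<noteq> 0\<close> by blast
  ultimately show ?thesis
    using assms(1) unfolding rsquarefree_def by (metis le_0_eq le_less less_one)
qed

text \<open>The product of the linear factors divides \<open>p\<close>. A nonconstant cofactor would
  have a root, which would be a double root of \<open>p\<close>; so the cofactor is constant, and
  being monic it is 1.\<close>

lemma monic_rsquarefree_eq_prod_roots:
  fixes p :: "'b::alg_closed_field poly"
  assumes "rsquarefree p" and monic: "Polynomial.lead_coeff p = 1"
  shows "p = (\<Prod>x | poly p x = 0. [:-x, 1:])"
proof -
  define R where "R = {x. poly p x = 0}"
  have p0: "p \<noteq> 0"
    using assms by auto
  then have fin: "finite R"
    unfolding R_def by (rule poly_roots_finite)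
  have "(\<Prod>x\<in>R. [:-x, 1:]) dvd p"
  proof (rule prod_dvd_of_prime_elems[OF fin])
    show "prime_elem [:-x, 1:]" for x :: 'b
      by (simp add: prime_elem_linear_field_poly)
    show "[:-x, 1:] dvd p" if "x \<in> R" for x
      using that by (simp add: R_def poly_eq_0_iff_dvd)
    show "x = y" if "[:-x, 1:] dvd [:-y, 1:]" for x y :: 'b
      using that by (simp flip: poly_eq_0_iff_dvd)
  qed
  then obtain q where q: "p = (\<Prod>x\<in>R. [:-x, 1:]) * q"
    by blast
  have "Polynomial.degree q = 0"
  proof (rule ccontr)
    assume "Polynomial.degree q \<noteq> 0"
    then obtain y where y: "poly q y = 0"
      using alg_closed_imp_poly_has_root by auto
    then have "poly p y = 0"
      by (subst q) simp
    then have "y \<in> R"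
      by (simp add: R_def)
    then have "[:-y, 1:] dvd (\<Prod>x\<in>R. [:-x, 1:])"
      using dvd_prodI[OF fin, of y "\<lambda>x. [:-x, 1:]"] by simp
    then have "[:-y, 1:] ^ 2 dvd p"
      using y unfolding q power2_eq_square by (intro mult_dvd_mono) (simp_all add: poly_eq_0_iff_dvd)
    then have "2 \<le> Polynomial.order y p"
      using p0 order_divides by blast
    then show False
      using assms(1) unfolding rsquarefree_def by (auto dest: spec[of _ y])
  qed
  moreover have "Polynomial.lead_coeff q = 1"
    using monic unfolding q lead_coeff_mult by (simp add: lead_coeff_prod)
  ultimately have "q = 1"
    by (auto elim!: degree_eq_zeroE)
  then show ?thesis
    using q by (simp add: R_def)
qed

section \<open>Frobenius and the finiteness of the base field\<close>

lemma prime_CHAR_finite_field: "Factorial_Ring.prime CHAR('a::{finite,field})"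
  by (simp add: prime_CHAR_semidom finite_imp_CHAR_pos)

lemma diff_power_CHAR_power:
  fixes x y :: "'b::comm_ring_1"
  assumes "Factorial_Ring.prime CHAR('b)"
  shows "(x - y) ^ (CHAR('b) ^ n) = x ^ (CHAR('b) ^ n) - y ^ (CHAR('b) ^ n)"
  \<comment> \<open>The additive identity is applied to \<open>(x - y) + y\<close>, which avoids
    determining the sign of a power of -1.\<close>
  using freshmans_dream'[OF assms refl, of "x - y" y n] by (simp add: algebra_simps)

text \<open>An iterate of Frobenius is injective, because the ring has no nilpotents, and hence
  surjective on a finite field.\<close>

lemma CHAR_power_root_exists:
  fixes l :: "'a::{finite,field}"
  shows "\<exists>u. u ^ (CHAR('a) ^ v) = l"
proof -
  have "inj (\<lambda>x::'a. x ^ (CHAR('a) ^ v))"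
  proof (rule injI)
    fix x y :: 'a assume "x ^ (CHAR('a) ^ v) = y ^ (CHAR('a) ^ v)"
    then have "(x - y) ^ (CHAR('a) ^ v) = 0"
      by (simp add: diff_power_CHAR_power prime_CHAR_finite_field)
    then show "x = y" by simp
  qed
  then show ?thesis
    by (metis finite_UNIV_inj_surj finite surjD)
qed

lemma finite_poly_degree_less: "finite {p :: 'a::{finite,zero} poly. Polynomial.degree p < n}"
proof (rule finite_subset)
  show "{p :: 'a poly. Polynomial.degree p < n} \<subseteq> Poly ` {xs. set xs \<subseteq> UNIV \<and> length xs \<le> n}"
  proof
    fix p :: "'a poly" assume "p \<in> {p. Polynomial.degree p < n}"
    then have "length (coeffs p) \<le> n"
      by (cases "p = 0") (auto simp: length_coeffs_degree)
    then show "p \<in> Poly ` {xs. set xs \<subseteq> UNIV \<and> length xs \<le> n}"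
      by (intro image_eqI[of _ _ "coeffs p"]) auto
  qed
  show "finite (Poly ` {xs :: 'a list. set xs \<subseteq> UNIV \<and> length xs \<le> n})"
    by (intro finite_imageI finite_lists_length_le) simp
qed

text \<open>\<open>X\<close> is prime and does not divide \<open>f\<close>, so in
  \<open>X * (...) = f * k\<close> it divides \<open>k\<close>; the factors \<open>X\<close> can
  thus be cancelled one at a time.\<close>

lemma dvd_X_power_mult_cancel:
  fixes f :: "'a::field poly"
  assumes "coprime f [:0, 1:]" and "f dvd [:0, 1:] ^ i * h"
  shows "f dvd h"
proof -
  have X: "prime_elem ([:0, 1:] :: 'a poly)"
    using prime_elem_linear_field_poly[of 1 "0 :: 'a"] by simp
  have "\<not> [:0, 1:] dvd f"
    using assms(1) X coprime_common_divisor[of f "[:0, 1:]" "[:0, 1:]"] by (auto simp: prime_elem_def)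
  with assms(2) show ?thesis
  proof (induction i)
    case (Suc i)
    then obtain k where k: "[:0, 1:] * ([:0, 1:] ^ i * h) = f * k"
      by (auto simp only: power_Suc mult.assoc elim: dvdE)
    then have "[:0, 1:] dvd f * k"
      by (metis dvd_triv_left)
    then have "[:0, 1:] dvd k"
      using X Suc.prems(2) by (simp add: prime_elem_dvd_mult_iff)
    then obtain k' where "k = [:0, 1:] * k'" ..
    then have "[:0, 1:] * ([:0, 1:] ^ i * h) = [:0, 1:] * (f * k')"
      using k by (simp only: mult.left_commute)
    then have "[:0, 1:] ^ i * h = f * k'"
      using X by (subst (asm) mult_left_cancel) auto
    then show ?case
      using Suc by simp
  qed simp
qed

text \<open>Pigeonhole on the finitely many remainders of \<open>X\<^sup>i\<close> modulo \<open>f\<close>.\<close>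
lemma dvd_X_power_minus_1_exists:
  fixes f :: "'a::{finite,field} poly"
  assumes "Polynomial.degree f > 0" and "coprime f [:0, 1:]"
  shows "\<exists>n>0. f dvd [:0, 1:] ^ n - 1"
proof -
  have "\<not> inj (\<lambda>i::nat. [:0, 1:] ^ i mod f)"
  proof
    assume "inj (\<lambda>i::nat. [:0, 1:] ^ i mod f)"
    moreover have "Polynomial.degree (g mod f) < Polynomial.degree f" for g
      using assms(1) degree_mod_less[of f g] by (metis degree_0 less_numeral_extra(3))
    then have "finite (range (\<lambda>i::nat. [:0, 1:] ^ i mod f))"
      by (intro finite_subset[OF _ finite_poly_degree_less[of "Polynomial.degree f"]]) blast
    ultimately show False
      using finite_imageD infinite_UNIV_nat by blast
  qed
  then obtain i j :: nat where "i < j" and ij: "[:0, 1:] ^ i mod f = [:0, 1:] ^ j mod f"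
    unfolding inj_def by (metis linorder_neqE_nat)
  have "f dvd [:0, 1:] ^ j - [:0, 1:] ^ i"
    using ij by (metis mod_eq_dvd_iff)
  also have "[:0, 1:] ^ j - [:0, 1:] ^ i = [:0, 1:] ^ i * ([:0, 1:] ^ (j - i) - 1 :: 'a poly)"
    using \<open>i < j\<close> by (simp add: algebra_simps flip: power_add)
  finally have "f dvd [:0, 1:] ^ (j - i) - 1"
    by (rule dvd_X_power_mult_cancel[OF assms(2)])
  then show ?thesis
    using \<open>i < j\<close> by (intro exI[of _ "j - i"]) simp
qed

section \<open>The radical and its order\<close>

lemma finite_monic_irreducible_divisors:
  fixes f :: "'a::{finite,field} poly"
  assumes "f \<noteq> 0"
  shows "finite {g. Factorial_Ring.irreducible g \<and> Polynomial.lead_coeff g = 1 \<and> g dvd f}"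
  by (rule finite_subset[OF _ finite_poly_degree_less[of "Suc (Polynomial.degree f)"]])
    (use assms in \<open>auto simp: less_Suc_eq_le dvd_imp_degree_le\<close>)

lemma monic_irreducible_dvd_imp_eq:
  fixes g h :: "'a::field poly"
  assumes "Factorial_Ring.irreducible g" "Factorial_Ring.irreducible h"
    and "Polynomial.lead_coeff g = 1" "Polynomial.lead_coeff h = 1" and "g dvd h"
  shows "g = h"
proof -
  obtain k where k: "h = g * k"
    using assms(5) by blast
  have "k dvd 1"
    using assms(1,2) irreducibleD[OF assms(2) k] irreducible_not_unit by blast
  then have "Polynomial.degree k = 0"
    by (metis is_unit_iff_degree not_is_unit_0)
  moreover have "Polynomial.lead_coeff k = 1"
    using assms(3,4) unfolding k lead_coeff_mult by simp
  ultimately show ?thesis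
    using k by (auto elim!: degree_eq_zeroE)
qed

text \<open>Distinct monic irreducible polynomials are primes that do not divide one another, so
  their product divides \<open>h\<close> as soon as each of them does. All later divisibility facts
  about the radical go through this criterion.\<close>

lemma poly_rad_dvd_iff:
  fixes f :: "'a::{finite,field} poly"
  assumes "f \<noteq> 0"
  shows "poly_rad f dvd h \<longleftrightarrow>
    (\<forall>g. Factorial_Ring.irreducible g \<and> Polynomial.lead_coeff g = 1 \<and> g dvd f \<longrightarrow> g dvd h)"
proof
  note fin = finite_monic_irreducible_divisors[OF assms]
  show "poly_rad f dvd h \<Longrightarrow> \<forall>g. Factorial_Ring.irreducible g \<and> Polynomial.lead_coeff g = 1 \<and>
    g dvd f \<longrightarrow> g dvd h"
    unfolding poly_rad_def using fin by (auto intro: dvd_trans[OF dvd_prodI[OF fin]])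
  show "\<forall>g. Factorial_Ring.irreducible g \<and> Polynomial.lead_coeff g = 1 \<and> g dvd f \<longrightarrow> g dvd h
    \<Longrightarrow> poly_rad f dvd h"
    unfolding poly_rad_def using fin
    by (intro prod_dvd_of_prime_elems)
      (auto intro: field_poly_irreducible_imp_prime monic_irreducible_dvd_imp_eq)
qed

text \<open>Each irreducible factor is prime, so it divides \<open>h\<close> once it divides a power
  of \<open>h\<close>.\<close>

lemma poly_rad_dvd_power_imp_dvd:
  fixes f :: "'a::{finite,field} poly"
  assumes "f \<noteq> 0" and "poly_rad f dvd h ^ n"
  shows "poly_rad f dvd h"
  using assms by (auto simp: poly_rad_dvd_iff intro: prime_elem_dvd_power
      field_poly_irreducible_imp_prime)

lemma lead_coeff_poly_rad: "Polynomial.lead_coeff (poly_rad f) = 1"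
  by (simp add: poly_rad_def lead_coeff_prod)

lemma poly_ac_poly_rad_eq_0_iff:
  fixes f :: "'a::{finite,field} poly"
  assumes "f \<noteq> 0"
  shows "poly (ac_poly (poly_rad f)) x = 0 \<longleftrightarrow> poly (ac_poly f) x = 0"
proof
  have "poly_rad f dvd f"
    using assms by (simp add: poly_rad_dvd_iff)
  then obtain k where "f = poly_rad f * k" ..
  then have "ac_poly f = ac_poly (poly_rad f) * ac_poly k"
    by (metis ac_poly_mult)
  then show "poly (ac_poly (poly_rad f)) x = 0 \<Longrightarrow> poly (ac_poly f) x = 0"
    by simp
  assume "poly (ac_poly f) x = 0"
  then obtain g where g: "Factorial_Ring.irreducible g" "Polynomial.lead_coeff g = 1" "g dvd f"
    and x: "poly (ac_poly g) x = 0"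
    using minimal_polynomial_exists assms by blast
  have "g dvd poly_rad f"
    using g poly_rad_dvd_iff[OF assms, of "poly_rad f"] by simp
  then show "poly (ac_poly (poly_rad f)) x = 0"
    using x by (auto simp: ac_poly_mult elim!: dvdE)
qed

lemma poly_order_poly_rad:
  fixes f :: "'a::{finite,field} poly"
  assumes "Polynomial.degree f > 0" and "coprime f [:0, 1:]"
  shows "poly_order (poly_rad f) > 0"
    and "poly_rad f dvd [:0, 1:] ^ poly_order (poly_rad f) - 1"
    and "\<not> CHAR('a) dvd poly_order (poly_rad f)"
proof -
  let ?P = "\<lambda>m. m > 0 \<and> poly_rad f dvd [:0, 1:] ^ m - 1"
  define m where "m = poly_order (poly_rad f)"
  have f0: "f \<noteq> 0"
    using assms(1) by auto
  obtain n where n: "n > 0" "f dvd [:0, 1:] ^ n - 1"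
    using dvd_X_power_minus_1_exists[OF assms] by blast
  have "poly_rad f dvd f"
    using f0 by (simp add: poly_rad_dvd_iff)
  \<comment> \<open>An exponent that works for \<open>f\<close> works for its divisor
    \<open>poly_rad f\<close>, so the \<open>LEAST\<close> in \<open>poly_order\<close> is
    attained.\<close>
  then have "?P n"
    using n dvd_trans by blast
  then have m: "?P m"
    unfolding m_def poly_order_def by (rule LeastI)
  then show "m > 0" "poly_rad f dvd [:0, 1:] ^ m - 1"
    by auto
  show "\<not> CHAR('a) dvd m"
  proof
    have p: "Factorial_Ring.prime CHAR('a)"
      by (rule prime_CHAR_finite_field)
    assume "CHAR('a) dvd m"
    then obtain k where k: "m = k * CHAR('a)"
      by (metis dvdE mult.commute)
    have "([:0, 1:] ^ k - 1) ^ CHAR('a) = ([:0, 1:] ^ m - 1 :: 'a poly)"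
      using diff_power_CHAR_power[of "[:0, 1:] ^ k :: 'a poly" 1 1] p
      by (simp add: k power_mult)
    \<comment> \<open>Since \<open>X^m - 1\<close> is a power of \<open>X^k - 1\<close>, the radical
      already divides the latter, and \<open>k < m\<close> contradicts minimality.\<close>
    then have "poly_rad f dvd [:0, 1:] ^ k - 1"
      using m f0 by (metis poly_rad_dvd_power_imp_dvd)
    then have "m \<le> k"
      unfolding m_def poly_order_def using m k by (intro Least_le) auto
    then show False
      using k m prime_gt_1_nat[OF p] by auto
  qed
qed

text \<open>The radical divides \<open>X^m - 1\<close> for its order \<open>m\<close>, and that
  binomial is separable because the characteristic does not divide \<open>m\<close>.\<close>

lemma ac_poly_rad_eq_prod:
  fixes f :: "'a::{finite,field} poly"
  assumes "Polynomial.degree f > 0" and "coprime f [:0, 1:]"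
  shows "ac_poly (poly_rad f) = (\<Prod>x | poly (ac_poly f) x = 0. [:-x, 1:])"
proof -
  let ?m = "poly_order (poly_rad f)"
  have "ac_poly (poly_rad f) dvd ac_poly ([:0, 1:] ^ ?m - [:1:])"
    using poly_order_poly_rad(2)[OF assms] by (intro ac_poly_dvd) (simp add: one_pCons)
  moreover have "rsquarefree (ac_poly ([:0, 1:] ^ ?m - [:1:] :: 'a poly))"
    unfolding ac_poly_binomial using poly_order_poly_rad(3)[OF assms]
    by (intro rsquarefree_binomial) (simp_all add: of_nat_eq_0_iff_char_dvd)
  ultimately have "rsquarefree (ac_poly (poly_rad f))"
    using rsquarefree_dvd by blast
  then have "ac_poly (poly_rad f) = (\<Prod>x | poly (ac_poly (poly_rad f)) x = 0. [:-x, 1:])"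
    by (rule monic_rsquarefree_eq_prod_roots) (simp add: lead_coeff_ac_poly lead_coeff_poly_rad)
  also have "{x. poly (ac_poly (poly_rad f)) x = 0} = {x. poly (ac_poly f) x = 0}"
    using assms(1) poly_ac_poly_rad_eq_0_iff[of f] by (metis Polynomial.degree_0 less_irrefl)
  finally show ?thesis .
qed

section \<open>Powers of primitive roots of unity and defining sets\<close>

lemma primitive_root_of_unity_power_eq_1_iff:
  assumes "primitive_root_of_unity n z"
  shows "z ^ k = 1 \<longleftrightarrow> n dvd k"
proof
  have n: "n > 0" "z ^ n = 1"
    using assms by (auto simp: primitive_root_of_unity_def)
  show "z ^ k = 1" if "n dvd k"
    using that n by (auto simp: power_mult)
  assume "z ^ k = 1"
  moreover have "z ^ k = (z ^ n) ^ (k div n) * z ^ (k mod n)"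
    by (simp flip: power_mult power_add)
  ultimately have "z ^ (k mod n) = 1"
    using n by simp
  moreover have "k mod n < n"
    using n by simp
  ultimately show "n dvd k"
    using assms unfolding primitive_root_of_unity_def by (metis gr0I mod_eq_0_iff_dvd)
qed

lemma primitive_root_of_unity_power_mod:
  assumes "primitive_root_of_unity n z"
  shows "z ^ (k mod n) = z ^ k"
proof -
  have "z ^ k = (z ^ n) ^ (k div n) * z ^ (k mod n)"
    by (simp flip: power_mult power_add)
  then show ?thesis
    using assms by (simp add: primitive_root_of_unity_def)
qed

lemma primitive_root_of_unity_nonzero:
  assumes "primitive_root_of_unity n z"
  shows "z \<noteq> 0"
  using assms by (metis primitive_root_of_unity_def power_0_left less_irrefl zero_neq_one)

lemma primitive_root_of_unity_inj:
  assumes "primitive_root_of_unity n z"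
  shows "inj_on (\<lambda>i. z ^ i) {..<n}"
proof (rule linorder_inj_onI')
  fix i j assume "i \<in> {..<n}" "j \<in> {..<n}" "i < j"
  show "z ^ i \<noteq> z ^ j"
  proof
    assume "z ^ i = z ^ j"
    then have "z ^ i * z ^ (j - i) = z ^ i"
      using \<open>i < j\<close> by (metis le_add_diff_inverse less_imp_le power_add)
    then have "z ^ (j - i) = 1"
      using primitive_root_of_unity_nonzero[OF assms] by simp
    then show False
      using assms \<open>i < j\<close> \<open>j \<in> {..<n}\<close> by (auto simp: primitive_root_of_unity_def)
  qed
qed

text \<open>The \<open>n\<close> distinct powers of \<open>z\<close> are roots of
  \<open>X^n - 1\<close>, which by its degree has no others.\<close>

lemma root_of_unity_eq_primitive_power:
  fixes z :: "'b::field"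
  assumes z: "primitive_root_of_unity n z" and "x ^ n = 1"
  obtains i where "i < n" "x = z ^ i"
proof -
  let ?p = "[:0, 1:] ^ n - [:1 :: 'b:]"
  have n: "n > 0" "z ^ n = 1"
    using z by (auto simp: primitive_root_of_unity_def)
  have p: "?p \<noteq> 0" "Polynomial.degree ?p = n"
    using degree_lead_coeff_binomial[OF n(1), of "1 :: 'b"] n(1) by auto
  have "(\<lambda>i. z ^ i) ` {..<n} = {x. poly ?p x = 0}"
  proof (rule card_seteq)
    show "finite {x. poly ?p x = 0}"
      using p by (intro poly_roots_finite)
    have "(z ^ i) ^ n = 1" for i
      using n power_commuting_commutes by (metis mult.commute power_mult power_one)
    then show "(\<lambda>i. z ^ i) ` {..<n} \<subseteq> {x. poly ?p x = 0}"
      by auto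
    show "card {x. poly ?p x = 0} \<le> card ((\<lambda>i. z ^ i) ` {..<n})"
      using card_poly_roots_bound[OF p(1)] p(2)
      by (simp add: card_image primitive_root_of_unity_inj[OF z])
  qed
  then show ?thesis
    using assms(2) that by (force simp: set_eq_iff)
qed

lemma primitive_root_of_unity_power:
  assumes "primitive_root_of_unity (n * d) z"
  shows "primitive_root_of_unity n (z ^ d)"
proof -
  have "n * d > 0"
    using assms by (auto simp: primitive_root_of_unity_def)
  then show ?thesis
    unfolding primitive_root_of_unity_def
    by (auto simp: primitive_root_of_unity_power_eq_1_iff[OF assms] mult.commute
        simp flip: power_mult dest: dvd_imp_le)
qed

text \<open>Discharges the definite description: the exponents of the roots form a valid set, and
  any valid set is determined by the roots because
  \<open>\<gamma> \<mapsto> \<zeta>_m^\<gamma>\<close> is injective below the order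
  \<open>m\<close>.\<close>

lemma primitive_defining_set_eq:
  assumes z: "primitive_root_of_unity (poly_order g) (\<zeta> (poly_order g))"
    and g: "ac_poly g = (\<Prod>x\<in>R. [:-x, 1:])" and "finite R"
    and R: "\<And>x. x \<in> R \<Longrightarrow> x ^ poly_order g = 1"
  shows "primitive_defining_set \<zeta> g = {\<gamma>. \<gamma> < poly_order g \<and> \<zeta> (poly_order g) ^ \<gamma> \<in> R}"
proof -
  define m where "m = poly_order g"
  define w where "w = \<zeta> m"
  define T where "T = {\<gamma>. \<gamma> < m \<and> w ^ \<gamma> \<in> R}"
  have w: "primitive_root_of_unity m w"
    using z by (simp add: m_def w_def)
  have inj: "inj_on (\<lambda>i. w ^ i) {..<m}"
    by (rule primitive_root_of_unity_inj[OF w])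
  have "R = (\<lambda>i. w ^ i) ` T"
  proof (intro subset_antisym subsetI)
    fix x assume x: "x \<in> R"
    then obtain i where "i < m" "x = w ^ i"
      using root_of_unity_eq_primitive_power[OF w] R m_def by metis
    then show "x \<in> (\<lambda>i. w ^ i) ` T"
      using x by (auto simp: T_def)
  qed (auto simp: T_def)
  moreover have "inj_on (\<lambda>i. w ^ i) T"
    by (rule inj_on_subset[OF inj]) (auto simp: T_def)
  ultimately have "(\<Prod>x\<in>R. [:-x, 1:]) = (\<Prod>\<gamma>\<in>T. [:-(w ^ \<gamma>), 1:])"
    by (metis (no_types, lifting) prod.reindex_cong)
  then have ex: "ac_poly g = Polynomial.smult (to_ac 1) (\<Prod>\<gamma>\<in>T. [:-(w ^ \<gamma>), 1:])"
    by (simp add: g)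
  show ?thesis
    unfolding primitive_defining_set_def m_def[symmetric] w_def[symmetric] T_def[symmetric]
  proof (rule the_equality)
    show "T \<subseteq> {0..<m} \<and> (\<exists>a. a \<noteq> 0 \<and>
        ac_poly g = Polynomial.smult (to_ac a) (\<Prod>\<gamma>\<in>T. [:-(w ^ \<gamma>), 1:]))"
      using ex by (auto simp: T_def intro!: exI[of _ 1])
    fix T' assume T': "T' \<subseteq> {0..<m} \<and> (\<exists>a. a \<noteq> 0 \<and>
        ac_poly g = Polynomial.smult (to_ac a) (\<Prod>\<gamma>\<in>T'. [:-(w ^ \<gamma>), 1:]))"
    then obtain a where a: "a \<noteq> 0"
      "ac_poly g = Polynomial.smult (to_ac a) (\<Prod>\<gamma>\<in>T'. [:-(w ^ \<gamma>), 1:])" by blast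
    have fin: "finite T'"
      using T' finite_subset by blast
    \<comment> \<open>Both conditions express that \<open>w ^ \<gamma>\<close> is a root of
      \<open>g\<close>, read off from the two factorizations.\<close>
    have "\<gamma> \<in> T' \<longleftrightarrow> w ^ \<gamma> \<in> R" if "\<gamma> < m" for \<gamma>
    proof -
      have "w ^ \<gamma> \<in> R \<longleftrightarrow> poly (ac_poly g) (w ^ \<gamma>) = 0"
        using \<open>finite R\<close> by (simp add: g poly_prod)
      also have "\<dots> \<longleftrightarrow> (\<exists>\<gamma>'\<in>T'. w ^ \<gamma> = w ^ \<gamma>')"
        using a fin by (simp add: poly_prod)
      also have "\<dots> \<longleftrightarrow> \<gamma> \<in> T'"
      proof
        assume "\<exists>\<gamma>'\<in>T'. w ^ \<gamma> = w ^ \<gamma>'"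
        then obtain \<gamma>' where "\<gamma>' \<in> T'" "w ^ \<gamma> = w ^ \<gamma>'" by blast
        moreover from this have "\<gamma> = \<gamma>'"
          using T' that by (intro inj_onD[OF inj]) auto
        ultimately show "\<gamma> \<in> T'" by simp
      qed blast
      finally show ?thesis by simp
    qed
    then show "T' = T"
      using T' by (auto simp: T_def)
  qed
qed

text \<open>Two elements have the same \<open>n\<close>-th power iff their quotient is an
  \<open>n\<close>-th root of unity, that is, a power of \<open>z ^ d\<close>. On exponents, this is
  a shift by a multiple of \<open>d\<close> modulo \<open>n * d\<close>.\<close>

lemma exponents_of_binomial_roots:
  assumes z: "primitive_root_of_unity (n * d) z"
  shows "{\<gamma>. \<gamma> < n * d \<and> (z ^ \<gamma>) ^ n = (z ^ \<gamma>\<^sub>0) ^ n} = (\<lambda>i. (\<gamma>\<^sub>0 + i * d) mod (n * d)) ` {0..<n}"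
    (is "?T = ?E")
proof
  note zmod = primitive_root_of_unity_power_mod[OF z]
  note z0 = primitive_root_of_unity_nonzero[OF z]
  have m: "n * d > 0" "z ^ (n * d) = 1"
    using z by (auto simp: primitive_root_of_unity_def)
  show "?E \<subseteq> ?T"
  proof
    fix \<gamma> assume "\<gamma> \<in> ?E"
    then obtain i where i: "\<gamma> = (\<gamma>\<^sub>0 + i * d) mod (n * d)"
      by auto
    have "(z ^ \<gamma>) ^ n = (z ^ \<gamma>\<^sub>0) ^ n * (z ^ (n * d)) ^ i"
      unfolding i zmod by (simp add: power_add power_mult_distrib mult_ac flip: power_mult)
    then show "\<gamma> \<in> ?T"
      using m i by simp
  qed
  show "?T \<subseteq> ?E"
  proof
    fix \<gamma> assume \<gamma>: "\<gamma> \<in> ?T"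
    then have "(z ^ \<gamma> / z ^ \<gamma>\<^sub>0) ^ n = 1"
      using z0 by (simp add: power_divide)
    then obtain i where i: "i < n" "z ^ \<gamma> / z ^ \<gamma>\<^sub>0 = (z ^ d) ^ i"
      using root_of_unity_eq_primitive_power[OF primitive_root_of_unity_power[OF z]] by blast
    have "z ^ \<gamma> = z ^ (\<gamma>\<^sub>0 + i * d)"
      using i(2) z0 by (simp add: field_simps power_add flip: power_mult)
    then have "z ^ \<gamma> = z ^ ((\<gamma>\<^sub>0 + i * d) mod (n * d))"
      by (simp only: zmod)
    then have "\<gamma> = (\<gamma>\<^sub>0 + i * d) mod (n * d)"
      using \<gamma> m(1) by (intro inj_onD[OF primitive_root_of_unity_inj[OF z]]) auto
    then show "\<gamma> \<in> ?E"
      using i(1) by auto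
  qed
qed

text \<open>Translation by 1 permutes the field, so comparing the sums of all elements shows that
  the cardinality is zero in the field. The prime characteristic therefore divides
  \<open>p ^ e\<close>.\<close>

lemma CHAR_eq_of_card_prime_power:
  assumes "Factorial_Ring.prime p" and "card (UNIV :: 'a::{finite,field} set) = p ^ e"
  shows "CHAR('a) = p"
proof -
  have "(\<Sum>x\<in>UNIV. x + 1) = (\<Sum>x\<in>UNIV. x :: 'a)"
    by (rule sum.reindex_bij_witness[of _ "\<lambda>x. x - 1" "\<lambda>x. x + 1"]) auto
  then have "of_nat (p ^ e) = (0 :: 'a)"
    by (simp add: sum.distrib assms(2))
  then have "CHAR('a) dvd p ^ e"
    by (simp only: of_nat_eq_0_iff_char_dvd)
  then show ?thesis
    using assms(1) prime_CHAR_finite_field[where ?'a = 'a] prime_dvd_power primes_dvd_imp_eq by blast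
qed


section \<open>Binomials and equal-difference defining sets\<close>

theorem theorem4:
  fixes p e q :: nat
    and f :: "'a::{finite, field} poly"
    and \<zeta> :: "nat \<Rightarrow> 'a alg_closure"
  assumes "Factorial_Ring.prime p"
    and "q = p ^ e"
    and "card (UNIV :: 'a set) = q"
    and "compatible_roots_of_unity q \<zeta>"
    and "Polynomial.degree f > 0"
    and "Polynomial.lead_coeff f = 1"
    and "coprime f [:0, 1:]"
  shows "is_binomial f \<longleftrightarrow>
    (\<exists>v::nat. f = poly_rad f ^ (p ^ v) \<and>
       equal_difference_subset (poly_order (poly_rad f))
         (primitive_defining_set \<zeta> (poly_rad f)))"
proof -
  define r where "r = poly_rad f"
  define m where "m = poly_order r"
  define z where "z = \<zeta> m"
  define R where "R = {x. poly (ac_poly f) x = 0}"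
  have CHAR: "CHAR('a) = p"
    using assms(1-3) CHAR_eq_of_card_prime_power by blast
  have f0: "f \<noteq> 0"
    using assms(5) by auto
  have prim: "primitive_root_of_unity n (\<zeta> n)" if "\<not> p dvd n" for n
  proof -
    have "coprime n p"
      using prime_imp_coprime[OF assms(1) that] by (simp add: coprime_commute)
    then show ?thesis
      using assms(2,4) by (simp add: compatible_roots_of_unity_def)
  qed
  have m: "m > 0" "r dvd [:0, 1:] ^ m - 1" "\<not> p dvd m"
    unfolding m_def r_def using poly_order_poly_rad[OF assms(5,7)] CHAR by auto
  have z: "primitive_root_of_unity m z"
    using m(3) prim by (simp add: z_def)
  have r: "ac_poly r = (\<Prod>x\<in>R. [:-x, 1:])"
    unfolding r_def R_def by (rule ac_poly_rad_eq_prod[OF assms(5,7)])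
  have "ac_poly f \<noteq> 0"
    using f0 ac_poly_eq_iff[of f 0] by simp
  then have fin: "finite R"
    unfolding R_def by (rule poly_roots_finite)
  have R1: "x ^ m = 1" if "x \<in> R" for x
  proof -
    have "poly (ac_poly r) x = 0"
      using that fin by (auto simp: r poly_prod)
    moreover have "ac_poly r dvd [:0, 1:] ^ m - [:1:]"
      using ac_poly_dvd[OF m(2)] ac_poly_binomial[of m "1 :: 'a"] by (simp add: one_pCons)
    ultimately have "poly ([:0, 1:] ^ m - [:1:]) x = 0"
      by (metis dvdE mult_zero_left poly_mult)
    then show ?thesis by simp
  qed
  have T: "primitive_defining_set \<zeta> r = {\<gamma>. \<gamma> < m \<and> z ^ \<gamma> \<in> R}"
    unfolding m_def z_def using z r fin R1
    by (intro primitive_defining_set_eq) (simp_all add: m_def z_def)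
  \<comment> \<open>Over the closure both sides are the product of \<open>X - x\<close> over the
    same set \<open>R\<close>; equality descends because \<open>to_ac\<close> is injective on
    coefficients.\<close>
  have r_eq: "r = [:0, 1:] ^ n - [:u:]"
    if "\<not> p dvd n" "u \<noteq> 0" "R = {x. x ^ n = to_ac u}" for n u
  proof -
    have "rsquarefree (ac_poly ([:0, 1:] ^ n - [:u:]))"
      unfolding ac_poly_binomial using that
      by (intro rsquarefree_binomial) (simp_all add: of_nat_eq_0_iff_char_dvd CHAR)
    moreover have "n > 0"
      using that(1) by (auto intro: gr0I)
    then have "Polynomial.lead_coeff (ac_poly ([:0, 1:] ^ n - [:u:])) = 1"
      by (simp only: lead_coeff_ac_poly degree_lead_coeff_binomial(2) to_ac_1)
    ultimately have "ac_poly ([:0, 1:] ^ n - [:u:]) =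
        (\<Prod>x | poly (ac_poly ([:0, 1:] ^ n - [:u:])) x = 0. [:-x, 1:])"
      by (rule monic_rsquarefree_eq_prod_roots)
    also have "{x. poly (ac_poly ([:0, 1:] ^ n - [:u:])) x = 0} = R"
      unfolding ac_poly_binomial by (simp add: that(3))
    finally show ?thesis
      by (metis r ac_poly_eq_iff)
  qed
  have frob: "([:0, 1:] ^ n - [:u:]) ^ (p ^ v) = [:0, 1:] ^ (n * p ^ v) - [:u ^ (p ^ v):]"
    for n v and u :: 'a
    using diff_power_CHAR_power[of "[:0, 1:] ^ n" "[:u:]" v] assms(1)
    by (simp add: CHAR power_mult poly_const_pow)
  show ?thesis
    unfolding r_def[symmetric] m_def[symmetric] T
  proof
    assume "is_binomial f"
    then obtain N l where N: "N \<ge> 1" and l: "l \<noteq> 0" and f: "f = [:0, 1:] ^ N - [:l:]"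
      unfolding is_binomial_def by blast
    define v where "v = multiplicity p N"
    obtain n where n: "N = p ^ v * n" "\<not> p dvd n"
      using multiplicity_decompose'[of N p] N assms(1) prime_gt_1_nat[OF assms(1)]
      unfolding v_def by auto
    \<comment> \<open>Taking a \<open>p ^ v\<close>-th root of the constant makes \<open>f\<close>
      the \<open>p ^ v\<close>-th power of the separable binomial \<open>X^n - u\<close>.\<close>
    obtain u where u: "u ^ (p ^ v) = l"
      using CHAR_power_root_exists[of v l] CHAR by auto
    have "p ^ v > 0"
      using assms(1) by (simp add: prime_gt_0_nat)
    then have u0: "u \<noteq> 0"
      using l u by auto
    have f': "f = ([:0, 1:] ^ n - [:u:]) ^ (p ^ v)"
      unfolding frob f n u by (simp add: mult.commute)
    have R: "R = {x. x ^ n = to_ac u}"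
      using \<open>p ^ v > 0\<close> unfolding R_def f' ac_poly_power ac_poly_binomial by simp
    have fr: "f = r ^ (p ^ v)"
      using f' r_eq[OF n(2) u0 R] by simp
    have "n > 0"
      using n(2) by (auto intro: gr0I)
    then obtain x where x: "x ^ n = to_ac u"
      using nth_root_exists by blast
    then have xR: "x \<in> R"
      by (simp add: R)
    \<comment> \<open>\<open>R\<close> is stable under multiplication by \<open>\<zeta>\<^sub>n\<close>, hence \<open>n\<close> divides \<open>m\<close>.\<close>
    have \<omega>: "primitive_root_of_unity n (\<zeta> n)"
      by (rule prim[OF n(2)])
    then have "x * \<zeta> n \<in> R"
      using x by (simp add: R power_mult_distrib primitive_root_of_unity_def)
    then have "\<zeta> n ^ m = 1"
      using R1[OF xR] R1[of "x * \<zeta> n"] by (simp add: power_mult_distrib)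
    then obtain d where d: "m = n * d"
      using primitive_root_of_unity_power_eq_1_iff[OF \<omega>] by blast
    \<comment> \<open>The exponent of one chosen root \<open>x\<close> is the starting point of the
      progression; its difference is \<open>d = m / n\<close>.\<close>
    obtain g where g: "g < m" "x = z ^ g"
      using root_of_unity_eq_primitive_power[OF z R1[OF xR]] .
    have E: "{\<gamma>. \<gamma> < m \<and> z ^ \<gamma> \<in> R} = (\<lambda>i. (g + i * d) mod m) ` {0..<n}"
      using exponents_of_binomial_roots[of n d z g] z x by (simp add: R d g(2))
    have d': "m div d = n" "d > 0" "d dvd m"
      using d m(1) by auto
    have "equal_difference_subset m {\<gamma>. \<gamma> < m \<and> z ^ \<gamma> \<in> R}"
      unfolding equal_difference_subset_def
      by (rule exI[of _ g], rule exI[of _ d]) (simp only: d' g(1) E simp_thms)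
    then show "\<exists>v. f = r ^ (p ^ v) \<and> equal_difference_subset m {\<gamma>. \<gamma> < m \<and> z ^ \<gamma> \<in> R}"
      using fr by blast
  next
    assume "\<exists>v. f = r ^ (p ^ v) \<and> equal_difference_subset m {\<gamma>. \<gamma> < m \<and> z ^ \<gamma> \<in> R}"
    then obtain v g d where fr: "f = r ^ (p ^ v)" and "g < m" "d > 0" "d dvd m"
      and E: "{\<gamma>. \<gamma> < m \<and> z ^ \<gamma> \<in> R} = (\<lambda>i. (g + i * d) mod m) ` {0..<m div d}"
      unfolding equal_difference_subset_def by blast
    define n where "n = m div d"
    \<comment> \<open>The common \<open>n\<close>-th power of all \<open>z ^ \<gamma>\<close> with
      \<open>\<gamma>\<close> in the progression; so far it is known only as an element of the
      closure.\<close>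
    define c where "c = (z ^ g) ^ n"
    have mn: "m = n * d"
      using \<open>d dvd m\<close> by (simp add: n_def)
    have n: "\<not> p dvd n"
      using m(3) mn by auto
    have E': "{\<gamma>. \<gamma> < m \<and> z ^ \<gamma> \<in> R} = {\<gamma>. \<gamma> < m \<and> (z ^ \<gamma>) ^ n = c}"
      using exponents_of_binomial_roots[of n d z g] z E \<open>d > 0\<close> by (simp add: mn c_def flip: n_def)
    have zm: "z ^ m = 1"
      using z by (simp add: primitive_root_of_unity_def)
    \<comment> \<open>Both sets consist of \<open>m\<close>-th roots of unity, so the equality
      \<open>E'\<close> of exponent sets below \<open>m\<close> is enough.\<close>
    have R: "R = {x. x ^ n = c}"
    proof -
      have "x \<in> R \<longleftrightarrow> x ^ n = c" if x: "x ^ m = 1" for x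
      proof -
        obtain i where i: "i < m" "x = z ^ i"
          using root_of_unity_eq_primitive_power[OF z x] .
        have "i \<in> {\<gamma>. \<gamma> < m \<and> z ^ \<gamma> \<in> R} \<longleftrightarrow> i \<in> {\<gamma>. \<gamma> < m \<and> (z ^ \<gamma>) ^ n = c}"
          by (simp only: E')
        then show ?thesis
          using i by simp
      qed
      moreover have "x ^ m = 1" if "x ^ n = c" for x
      proof -
        have "x ^ m = c ^ d"
          using that by (simp add: mn power_mult)
        also have "\<dots> = (z ^ m) ^ g"
          unfolding c_def mn by (simp add: mult_ac flip: power_mult)
        finally show ?thesis
          by (simp add: zm)
      qed
      ultimately show ?thesis
        using R1 by blast
    qed
    have "c \<noteq> 0"
      using primitive_root_of_unity_nonzero[OF z] by (simp add: c_def)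
    have "n > 0"
      using n by (auto intro: gr0I)
    \<comment> \<open>Descent of \<open>c\<close> to the base field: over the closure
      \<open>r\<close> becomes \<open>X^n - c\<close>, so \<open>c\<close> is minus the constant
      coefficient of \<open>r\<close>, which lies in the base field.\<close>
    define u where "u = - Polynomial.coeff r 0"
    have "rsquarefree ([:0, 1:] ^ n - [:c:])"
      using n \<open>c \<noteq> 0\<close> by (intro rsquarefree_binomial) (simp_all add: of_nat_eq_0_iff_char_dvd CHAR)
    then have "[:0, 1:] ^ n - [:c:] = (\<Prod>x | poly ([:0, 1:] ^ n - [:c:]) x = 0. [:-x, 1:])"
      using degree_lead_coeff_binomial(2)[OF \<open>n > 0\<close>] by (rule monic_rsquarefree_eq_prod_roots)
    then have "ac_poly r = [:0, 1:] ^ n - [:c:]"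
      by (simp add: r R)
    then have "- c = to_ac (Polynomial.coeff r 0)"
      using \<open>n > 0\<close> coeff_map_poly[of to_ac r 0] by (simp add: coeff_0_power power_0_left)
    then have "to_ac u = c"
      by (metis u_def to_ac_minus minus_minus)
    then have u: "u \<noteq> 0" "r = [:0, 1:] ^ n - [:u:]"
      using r_eq[OF n, of u] R \<open>c \<noteq> 0\<close> by auto
    have "f = [:0, 1:] ^ (n * p ^ v) - [:u ^ (p ^ v):]"
      using fr unfolding u(2) frob .
    moreover have "n * p ^ v \<ge> 1"
      using \<open>n > 0\<close> prime_gt_0_nat[OF assms(1)] by (simp add: Suc_le_eq)
    moreover have "u ^ (p ^ v) \<noteq> 0"
      using u(1) by simp
    ultimately show "is_binomial f"
      unfolding is_binomial_def by (intro exI conjI)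
  qed
qed

end
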